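(* Let $\mathcal{X}$ be a Banach space. Let $A\colon\Omega\to\mathcal{L}(\mathcal{X})$ be a random operator such that $\|A\|$ is bounded, regarded as the generator of the random semigroup $e^{At}$. Let $A, A_1, A_2, \ldots$ be a sequence of i.i.d. random operators. Then $e^{A_1t/n}\cdots e^{A_nt/n}$ converges almost surely in the weak operator topology to $e^{(\mathbb{E}A)t}$, uniformly for $t$ in any segment; that is, for any $x\in\mathcal{X}$, $f\in\mathcal{X}^*$ and $T>0$, almost surely $$\lim_{n\to\infty}\ \sup_{t\in[0,T]}\ \left|\left\langle f,\left(e^{A_1t/n}\cdots e^{A_nt/n}-e^{(\mathbb{E}A)t}\right)x\right\rangle\right|=0.$$
   Context: Banach spaces are over $\mathbb{K}=\mathbb{R}$ or $\mathbb{C}$. $\mathcal{L}(\mathcal{X})$ is the Banach space (operator norm) of bounded linear operators $\mathcal{X}\to\mathcal{X}$; $\mathcal{X}^*$ is the dual space of continuous linear functionals, and $\langle f,x\rangle:=f(x)$. $(\Omega,\mathcal{F},\mathrm{P})$ is a probability space with a complete $\sigma$-additive measure. A random element of a Banach space $\mathcal{Y}$ is a Bochner measurable map $\xi\colon\Omega\to\mathcal{Y}$; equivalently (Pettis), $\xi$ is weakly measurable ($\langle f,\xi\rangle$ is measurable for every $f\in\mathcal{Y}^*$) and almost surely takes values in a norm-separable subset of $\mathcal{Y}$. A random operator is a random element of a space of bounded linear operators (with the operator norm). $\mathbb{E}$ denotes the Bochner integral. Random elements $\xi_n\colon\Omega\to\mathcal{X}_n$ are independent if $\mathrm{P}\{\xi_1\in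 O_1,\ldots,\xi_n\in O_n\}=\mathrm{P}\{\xi_1\in O_1\}\cdots\mathrm{P}\{\xi_n\in O_n\}$ for all $n$ and all open $O_k\subset\mathcal{X}_k$; i.i.d. means independent and identically distributed. For a random operator $A$ with bounded norm, $e^{At}$ is the random uniformly continuous semigroup with infinitesimal generator $A$. *)

theory Defs
  imports "HOL-Probability.Probability"
begin

text \<open>
  Banach spaces over \<open>K\<close>, where \<open>K\<close> is the field of real or of complex numbers.  The norm, its
  completeness and the underlying real vector space come from the class \<open>banach\<close>; multiplication
  by scalars from \<open>K\<close> is the parameter \<open>scaleK\<close>.  The class \<open>real_normed_field\<close> has a
  multiplicative norm, so by Gelfand--Mazur (applied to the completion) its members are, up to
  isometric isomorphism, exactly \<open>real\<close> and \<open>complex\<close>.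
\<close>

locale banach_space_over = vector_space scaleK
  for scaleK :: "'k::real_normed_field \<Rightarrow> 'a::banach \<Rightarrow> 'a" +
  assumes norm_scale: "norm (scaleK c x) = norm c * norm x"
    and scale_of_real: "scaleK (of_real r) x = r *\<^sub>R x"

text \<open>
  The type of bounded real-linear maps carries the operator norm; the \<open>K\<close>-linear maps form a closed
  real subspace of it, with the same norm and the subspace topology.  For real scalars the
  linearity condition is automatic.
\<close>

definition operator_space :: "('k::real_normed_field \<Rightarrow> 'a::banach \<Rightarrow> 'a) \<Rightarrow> ('a \<Rightarrow>\<^sub>L 'a) set"
  where "operator_space scaleK = {B. Vector_Spaces.linear scaleK scaleK (blinfun_apply B)}"

definition dual_space :: "('k::real_normed_field \<Rightarrow> 'a::banach \<Rightarrow> 'a) \<Rightarrow> ('a \<Rightarrow>\<^sub>L 'k) set"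
  where "dual_space scaleK = {f. Vector_Spaces.linear scaleK (*) (blinfun_apply f)}"

lemma banach_space_over_scaleR: "banach_space_over (scaleR :: real \<Rightarrow> 'a::banach \<Rightarrow> 'a)"
  by unfold_locales (simp_all add: algebra_simps)

lemma operator_space_scaleR: "operator_space (scaleR :: real \<Rightarrow> 'a::banach \<Rightarrow> 'a) = UNIV"
  using bounded_linear.linear[OF blinfun.bounded_linear_right]
  by (auto simp: operator_space_def linear_def)

lemma dual_space_scaleR: "dual_space (scaleR :: real \<Rightarrow> 'a::banach \<Rightarrow> 'a) = UNIV"
proof -
  have "((*) :: real \<Rightarrow> real \<Rightarrow> real) = scaleR"
    by (simp add: fun_eq_iff)
  then show ?thesis
    using bounded_linear.linear[OF blinfun.bounded_linear_right]
    by (auto simp: dual_space_def linear_def)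
qed

lemma banach_space_over_complex: "banach_space_over ((*) :: complex \<Rightarrow> complex \<Rightarrow> complex)"
  by unfold_locales (simp_all add: algebra_simps norm_mult scaleR_conv_of_real)

text \<open>
  The library's Bochner integral is restricted to second countable spaces, which excludes spaces
  of operators.  The definitions below are the usual ones, via approximation by simple functions.
\<close>

definition bochner_measurable :: "'w measure \<Rightarrow> ('w \<Rightarrow> 'b::real_normed_vector) \<Rightarrow> bool"
  where "bochner_measurable M \<xi> \<longleftrightarrow>
    (\<exists>s. (\<forall>i. simple_function M (s i)) \<and> (AE \<omega> in M. (\<lambda>i::nat. s i \<omega>) \<longlonglongrightarrow> \<xi> \<omega>))"

definition has_bochner_int :: "'w measure \<Rightarrow> ('w \<Rightarrow> 'b::real_normed_vector) \<Rightarrow> 'b \<Rightarrow> bool"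
  where "has_bochner_int M \<xi> v \<longleftrightarrow> bochner_measurable M \<xi> \<and>
    (\<exists>s. (\<forall>i::nat. Bochner_Integration.simple_bochner_integrable M (s i)) \<and>
         (\<lambda>i. \<integral>\<^sup>+\<omega>. ennreal (norm (\<xi> \<omega> - s i \<omega>)) \<partial>M) \<longlonglongrightarrow> 0 \<and>
         (\<lambda>i. Bochner_Integration.simple_bochner_integral M (s i)) \<longlonglongrightarrow> v)"

definition bochner_int :: "'w measure \<Rightarrow> ('w \<Rightarrow> 'b::real_normed_vector) \<Rightarrow> 'b"
  where "bochner_int M \<xi> = (THE v. has_bochner_int M \<xi> v)"

definition random_operator ::
    "'w measure \<Rightarrow> ('k::real_normed_field \<Rightarrow> 'a::banach \<Rightarrow> 'a) \<Rightarrow> ('w \<Rightarrow> 'a \<Rightarrow>\<^sub>L 'a) \<Rightarrow> bool"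
  where "random_operator M scaleK A \<longleftrightarrow>
    bochner_measurable M A \<and> (\<forall>\<omega>\<in>space M. A \<omega> \<in> operator_space scaleK)"

definition iid :: "'w measure \<Rightarrow> (nat \<Rightarrow> 'w \<Rightarrow> 'b::topological_space) \<Rightarrow> bool"
  where "iid M \<xi> \<longleftrightarrow>
    prob_space.indep_vars M (\<lambda>_. borel) \<xi> UNIV \<and>
    (\<forall>i j. distr M borel (\<xi> i) = distr M borel (\<xi> j))"

text \<open>
  The exponential series is summed in operator norm.  The library's \<open>exp\<close> needs a Banach algebra
  class, of which the type of bounded operators is not an instance.
\<close>

definition op_exp :: "('a::banach \<Rightarrow>\<^sub>L 'a) \<Rightarrow> ('a \<Rightarrow>\<^sub>L 'a)"
  where "op_exp B = (\<Sum>k. (1 / fact k) *\<^sub>R (((o\<^sub>L) B ^^ k) id_blinfun))"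

text \<open>\<open>op_prod F n\<close> is \<open>F 1 o\<^sub>L \<dots> o\<^sub>L F n\<close>, in this order.\<close>

definition op_prod :: "(nat \<Rightarrow> 'a::banach \<Rightarrow>\<^sub>L 'a) \<Rightarrow> nat \<Rightarrow> ('a \<Rightarrow>\<^sub>L 'a)"
  where "op_prod F n = foldr (\<lambda>k B. F k o\<^sub>L B) [1..<Suc n] id_blinfun"

end

theory Submission
  imports Defs
begin

text \<open>
  The convergence holds even in operator norm, for a reason that separates cleanly into a
  deterministic and a probabilistic half.

  Deterministic half: if \<open>\<parallel>a k\<parallel> \<le> c\<close> and the averages \<open>(a 1 + \<dots> + a n) / n\<close> converge in norm to
  \<open>B\<close>, then the products \<open>exp (t a 1 / n) \<dots> exp (t a n / n)\<close> converge in norm to \<open>exp (t B)\<close>,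
  uniformly for \<open>t\<close> in a bounded interval.  Replacing the factors one at a time by \<open>exp (t B / n)\<close>
  costs about \<open>(t / n) (a k - B)\<close> at position \<open>k\<close>, which is not small compared with \<open>1 / n\<close>.  But these
  costs cancel along the product: their partial sums \<open>D k = \<Sum>i\<le>k. a i - B\<close> are \<open>o(n)\<close>, uniformly in
  \<open>k \<le> n\<close>, and summation by parts turns the first-order error into
  one of size \<open>max\<^sub>k \<parallel>D k\<parallel> / n\<close>.  The summation by parts is carried out by inserting the correction
  factor \<open>1 - (t / n) D k\<close> into the telescoping product (\<open>op_prod_exp_error\<close>); after that every
  telescoping step is of second order, by the estimate \<open>op_exp_step_error\<close> for the operator exponential
  over a short time step.

  Probabilistic half: the averages of the operators converge almost surely to the Bochner integral
  (\<open>average_tendsto_bochner_int_AE\<close>).  For bounded real variables this strong law follows from Hoeffding's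
  inequality and the Borel--Cantelli lemma, since the deviation probabilities decay geometrically.
  It extends to functions of finitely many values by linearity, and to a bounded Bochner measurable
  variable by approximating it in mean by a simple Borel function \<open>g\<close> of its value: the same function
  \<open>g\<close> then approximates every copy, and the real strong law applied to \<open>\<parallel>a - g a\<parallel>\<close> controls the average error.
\<close>

section \<open>The operator exponential over a short time step\<close>

abbreviation op_power :: "('a::real_normed_vector \<Rightarrow>\<^sub>L 'a) \<Rightarrow> nat \<Rightarrow> ('a \<Rightarrow>\<^sub>L 'a)"
  where "op_power X k \<equiv> ((o\<^sub>L) X ^^ k) id_blinfun"

lemmas blinfun_compose_bilinear =
  bounded_bilinear.add_left[OF bounded_bilinear_blinfun_compose]
  bounded_bilinear.add_right[OF bounded_bilinear_blinfun_compose]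
  bounded_bilinear.diff_left[OF bounded_bilinear_blinfun_compose]
  bounded_bilinear.diff_right[OF bounded_bilinear_blinfun_compose]
  bounded_bilinear.scaleR_left[OF bounded_bilinear_blinfun_compose]
  bounded_bilinear.scaleR_right[OF bounded_bilinear_blinfun_compose]

lemma blinfun_compose_id: "X o\<^sub>L id_blinfun = X" "id_blinfun o\<^sub>L X = X"
  by (auto intro!: blinfun_eqI)

lemma norm_id_blinfun_le: "norm (id_blinfun :: 'a::real_normed_vector \<Rightarrow>\<^sub>L 'a) \<le> 1"
  by (rule norm_blinfun_bound) auto

lemma norm_op_power_le:
  fixes X :: "'a::real_normed_vector \<Rightarrow>\<^sub>L 'a"
  assumes "norm X \<le> b"
  shows "norm (op_power X k) \<le> b ^ k"
proof (induction k)
  case 0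
  then show ?case by (simp add: norm_id_blinfun_le)
next
  case (Suc k)
  have "norm (X o\<^sub>L op_power X k) \<le> norm X * norm (op_power X k)"
    by (rule norm_blinfun_compose)
  also have "\<dots> \<le> b * b ^ k"
    using assms Suc order_trans[OF norm_ge_zero assms] by (intro mult_mono) auto
  finally show ?case by simp
qed

lemma op_power_scaleR: "op_power (t *\<^sub>R X) k = t ^ k *\<^sub>R op_power X k"
  by (induction k) (simp_all add: blinfun_compose_bilinear)

lemma op_exp_sums:
  fixes X :: "'a::banach \<Rightarrow>\<^sub>L 'a"
  shows "(\<lambda>k. (t ^ k / fact k) *\<^sub>R op_power X k) sums op_exp (t *\<^sub>R X)"
proof -
  have "summable (\<lambda>k. (t ^ k / fact k) *\<^sub>R op_power X k)"
  proof (rule summable_comparison_test')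
    show "summable (\<lambda>k. (\<bar>t\<bar> * norm X) ^ k / fact k)"
      using sums_summable[OF exp_converges[of "\<bar>t\<bar> * norm X"]] by (simp add: divide_inverse mult.commute)
    show "norm ((t ^ k / fact k) *\<^sub>R op_power X k) \<le> (\<bar>t\<bar> * norm X) ^ k / fact k" for k
      using norm_op_power_le[where X = X and k = k, OF order_refl]
      by (simp add: power_abs power_mult_distrib divide_right_mono mult_left_mono)
  qed
  moreover have "op_exp (t *\<^sub>R X) = (\<Sum>k. (t ^ k / fact k) *\<^sub>R op_power X k)"
    by (simp add: op_exp_def op_power_scaleR)
  ultimately show ?thesis
    by (simp add: summable_sums)
qed

text \<open>
  This is the nonnegativity of the Taylor remainder of \<open>(s + h) ^ Suc j\<close>.  It makes the coefficients
  in \<open>op_exp_step_majorant\<close> nonnegative.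
\<close>
lemma power_add_ge_linear_term:
  fixes s h :: real
  assumes "0 \<le> s" "0 \<le> h"
  shows "s ^ Suc j + real (Suc j) * h * s ^ j \<le> (s + h) ^ Suc j"
proof (induction j)
  case (Suc j)
  have "s ^ Suc (Suc j) + real (Suc (Suc j)) * h * s ^ Suc j
      \<le> (s + h) * (s ^ Suc j + real (Suc j) * h * s ^ j)"
    using assms by (simp add: algebra_simps)
  also have "\<dots> \<le> (s + h) * (s + h) ^ Suc j"
    using Suc assms by (intro mult_left_mono) auto
  finally show ?case by simp
qed simp

text \<open>
  The left-hand side is the norm of a power series in \<open>X\<close> whose coefficients, the remainders of the
  first-order expansion of \<open>(s + h) ^ k / fact k\<close> in \<open>h\<close>, are all nonnegative.  Hence it is at most
  the sum of the same series at the real number \<open>b \<ge> \<parallel>X\<parallel>\<close>, which is the right-hand side.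
\<close>
lemma op_exp_step_majorant:
  fixes X :: "'a::banach \<Rightarrow>\<^sub>L 'a"
  assumes X: "norm X \<le> b" and s: "0 \<le> s" and h: "0 \<le> h"
  shows "norm (op_exp ((s + h) *\<^sub>R X) - ((id_blinfun + h *\<^sub>R X) o\<^sub>L op_exp (s *\<^sub>R X)))
    \<le> exp ((s + h) * b) - (1 + h * b) * exp (s * b)"
proof -
  \<comment> \<open>\<open>p\<close> lists the coefficients of \<open>h X exp (s X)\<close>, a series whose exponents are shifted by one\<close>
  define p where "p = (\<lambda>k. case k of 0 \<Rightarrow> 0 | Suc j \<Rightarrow> h * (s ^ j / fact j))"
  define d where "d = (\<lambda>k. (s + h) ^ k / fact k - s ^ k / fact k - p k)"
  have b: "0 \<le> b" using X norm_ge_zero order_trans by blast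
  have d_nonneg: "0 \<le> d k" for k
  proof (cases k)
    case 0
    then show ?thesis by (simp add: d_def p_def)
  next
    case (Suc j)
    have "h * (s ^ j / fact j) = real (Suc j) * h * s ^ j / fact (Suc j)"
      by (simp add: fact_Suc del: of_nat_Suc)
    then have "d k = ((s + h) ^ Suc j - (s ^ Suc j + real (Suc j) * h * s ^ j)) / fact (Suc j)"
      by (simp only: d_def p_def Suc nat.case diff_divide_distrib add_divide_distrib)
    then show ?thesis
      using power_add_ge_linear_term[OF s h, of j] by (simp only: zero_le_divide_iff) simp
  qed
  have "(\<lambda>j. p (Suc j) *\<^sub>R op_power X (Suc j)) sums ((h *\<^sub>R X) o\<^sub>L op_exp (s *\<^sub>R X))"
    using bounded_linear.sums[OF bounded_bilinear.bounded_linear_right[OF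
        bounded_bilinear_blinfun_compose, of "h *\<^sub>R X"] op_exp_sums[of s X]]
    by (simp add: p_def blinfun_compose_bilinear mult_ac)
  from sums_Suc[OF this] have "(\<lambda>k. p k *\<^sub>R op_power X k) sums ((h *\<^sub>R X) o\<^sub>L op_exp (s *\<^sub>R X))"
    by (simp add: p_def)
  from sums_diff[OF sums_diff[OF op_exp_sums[of "s + h" X] op_exp_sums[of s X]] this]
  have op: "(\<lambda>k. d k *\<^sub>R op_power X k) sums
      (op_exp ((s + h) *\<^sub>R X) - ((id_blinfun + h *\<^sub>R X) o\<^sub>L op_exp (s *\<^sub>R X)))"
    by (simp add: d_def scaleR_left_diff_distrib scaleR_add_left diff_diff_eq
      blinfun_compose_bilinear blinfun_compose_id)
  have exp_sums: "(\<lambda>k. (t ^ k / fact k) * b ^ k) sums exp (t * b)" for t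
    using exp_converges[of "t * b"] by (simp add: power_mult_distrib field_simps)
  have "(\<lambda>j. p (Suc j) * b ^ Suc j) sums (h * b * exp (s * b))"
    using sums_mult[OF exp_sums[of s], of "h * b"] by (simp add: p_def mult_ac)
  from sums_Suc[OF this] have "(\<lambda>k. p k * b ^ k) sums (h * b * exp (s * b))"
    by (simp add: p_def)
  from sums_diff[OF sums_diff[OF exp_sums[of "s + h"] exp_sums[of s]] this]
  have re: "(\<lambda>k. d k * b ^ k) sums (exp ((s + h) * b) - (1 + h * b) * exp (s * b))"
    by (simp add: d_def algebra_simps)
  show ?thesis
  proof (rule norm_sums_le[OF op re])
    show "norm (d k *\<^sub>R op_power X k) \<le> d k * b ^ k" for k
      using norm_op_power_le[OF X, of k] d_nonneg[of k] by (simp add: mult_left_mono)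
  qed
qed

lemma exp_second_order_bound:
  fixes y :: real
  assumes "0 \<le> y"
  shows "exp y - (1 + y) \<le> y\<^sup>2 * exp y"
proof -
  have "(1 - y) * exp y \<le> exp (- y) * exp y"
    using exp_ge_add_one_self[of "- y"] by (intro mult_right_mono) auto
  then have "(1 + y) * ((1 - y) * exp y) \<le> (1 + y) * 1"
    using assms by (intro mult_left_mono) (auto simp flip: exp_add)
  then show ?thesis by (simp add: algebra_simps power2_eq_square)
qed

text \<open>
  One step of the Euler scheme for \<open>Q' = X Q\<close> has a local error of second order.  With \<open>s = 0\<close> this is the
  estimate of \<open>exp (h X) - 1 - h X\<close> for the random factors; with general \<open>s\<close> it compares consecutive
  values of the limit semigroup.
\<close>
lemma op_exp_step_error:
  fixes X :: "'a::banach \<Rightarrow>\<^sub>L 'a"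
  assumes X: "norm X \<le> b" and s: "0 \<le> s" and h: "0 \<le> h"
  shows "norm (op_exp ((s + h) *\<^sub>R X) - ((id_blinfun + h *\<^sub>R X) o\<^sub>L op_exp (s *\<^sub>R X)))
    \<le> (h * b)\<^sup>2 * exp ((s + h) * b)"
proof -
  have b: "0 \<le> b" using X norm_ge_zero order_trans by blast
  have "exp ((s + h) * b) - (1 + h * b) * exp (s * b)
      = exp (s * b) * (exp (h * b) - (1 + h * b))"
    by (simp add: algebra_simps exp_add)
  also have "\<dots> \<le> exp (s * b) * ((h * b)\<^sup>2 * exp (h * b))"
    using b h by (intro mult_left_mono exp_second_order_bound) auto
  also have "\<dots> = (h * b)\<^sup>2 * exp ((s + h) * b)"
    by (simp add: algebra_simps exp_add)
  finally show ?thesis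
    using op_exp_step_majorant[OF assms] by linarith
qed

lemma norm_op_exp_le:
  fixes X :: "'a::banach \<Rightarrow>\<^sub>L 'a"
  assumes X: "norm X \<le> b" and t: "0 \<le> t"
  shows "norm (op_exp (t *\<^sub>R X)) \<le> exp (t * b)"
proof (rule norm_sums_le[OF op_exp_sums[of t X]])
  show "(\<lambda>k. (t ^ k / fact k) * b ^ k) sums exp (t * b)"
    using exp_converges[of "t * b"] by (simp add: power_mult_distrib field_simps)
  show "norm ((t ^ k / fact k) *\<^sub>R op_power X k) \<le> (t ^ k / fact k) * b ^ k" for k
    using norm_op_power_le[OF X, of k] t by (simp add: mult_left_mono divide_right_mono)
qed

lemma op_exp_zero: "op_exp (0 :: 'a::banach \<Rightarrow>\<^sub>L 'a) = id_blinfun"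
proof -
  have "(\<lambda>k. (0 ^ k / fact k) *\<^sub>R op_power (0 :: 'a \<Rightarrow>\<^sub>L 'a) k) sums op_power 0 0"
    using sums_finite[of "{0}" "\<lambda>k. (0 ^ k / fact k) *\<^sub>R op_power (0 :: 'a \<Rightarrow>\<^sub>L 'a) k"] by simp
  from sums_unique2[OF this op_exp_sums[of 0 0]] show ?thesis by simp
qed

lemma op_prod_0: "op_prod F 0 = id_blinfun"
  by (simp add: op_prod_def)

lemma op_prod_Suc:
  fixes F :: "nat \<Rightarrow> 'a::banach \<Rightarrow>\<^sub>L 'a"
  shows "op_prod F (Suc n) = op_prod F n o\<^sub>L F (Suc n)"
proof -
  have foldr_compose: "foldr (\<lambda>k B. F k o\<^sub>L B) ks C = foldr (\<lambda>k B. F k o\<^sub>L B) ks id_blinfun o\<^sub>L C"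
    for ks and C :: "'a \<Rightarrow>\<^sub>L 'a"
    by (induction ks) (auto simp: blinfun_eqI)
  have upt: "[1..<Suc (Suc n)] = [1..<Suc n] @ [Suc n]" by simp
  from foldr_compose[of "[1..<Suc n]" "F (Suc n)"] show ?thesis
    by (simp only: op_prod_def upt foldr_append foldr.simps o_def id_def blinfun_compose_id)
qed

lemma norm_op_prod_le:
  assumes "\<And>k. 1 \<le> k \<Longrightarrow> k \<le> n \<Longrightarrow> norm (F k) \<le> K"
  shows "norm (op_prod F n) \<le> K ^ n"
  using assms
proof (induction n)
  case 0
  then show ?case by (simp add: op_prod_0 norm_id_blinfun_le)
next
  case (Suc n)
  have K: "norm (F (Suc n)) \<le> K" using Suc.prems by simp
  have "norm (op_prod F n o\<^sub>L F (Suc n)) \<le> norm (op_prod F n) * norm (F (Suc n))"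
    by (rule norm_blinfun_compose)
  also have "\<dots> \<le> K ^ n * K"
    using Suc K order_trans[OF norm_ge_zero K] by (intro mult_mono) auto
  finally show ?case by (simp add: op_prod_Suc mult_ac)
qed

section \<open>Products of exponentials of operators with convergent averages\<close>

text \<open>
  If \<open>u n = o(n)\<close>, then the running maximum is \<open>o(n)\<close> too: for a given \<open>e\<close> only finitely many \<open>k\<close> violate
  \<open>u k \<le> e k / 2\<close>, and their values are eventually below \<open>e n / 2\<close>.
\<close>
lemma running_maximum_average_tendsto_zero:
  fixes u :: "nat \<Rightarrow> real"
  assumes nonneg: "\<And>k. 0 \<le> u k" and lim: "(\<lambda>n. u n / real n) \<longlonglongrightarrow> 0"
  shows "(\<lambda>n. Max (u ` {..n}) / real n) \<longlonglongrightarrow> 0"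
proof (rule tendstoI)
  fix e :: real assume e: "0 < e"
  have "eventually (\<lambda>n. u n / real n < e / 2) sequentially"
    using order_tendstoD(2)[OF lim, of "e / 2"] e by simp
  then obtain N where N: "\<And>n. N \<le> n \<Longrightarrow> u n / real n < e / 2"
    by (auto simp: eventually_sequentially)
  define b where "b = Max (u ` {..N})"
  have "eventually (\<lambda>n. b / (e / 2) \<le> real n) sequentially"
    using filterlim_real_sequentially by (auto simp: filterlim_at_top)
  then show "eventually (\<lambda>n. dist (Max (u ` {..n}) / real n) 0 < e) sequentially"
    using eventually_gt_at_top[of 0]
  proof eventually_elim
    case (elim n)
    have "u k \<le> e / 2 * real n" if "k \<le> n" for k
    proof (cases "N \<le> k \<and> 0 < k")
      case True
      then have "u k < e / 2 * real k" using N[of k] by (simp add: field_simps)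
      also have "\<dots> \<le> e / 2 * real n" using that e by (intro mult_left_mono) auto
      finally show ?thesis by simp
    next
      case False
      then have "u k \<le> b" unfolding b_def by (intro Max_ge) auto
      also have "\<dots> \<le> e / 2 * real n" using elim e by (simp add: field_simps)
      finally show ?thesis .
    qed
    then have "Max (u ` {..n}) \<le> e / 2 * real n"
      by (subst Max_le_iff) auto
    then have "Max (u ` {..n}) / real n \<le> e / 2" using elim by (simp add: field_simps)
    moreover have "u n \<le> Max (u ` {..n})" by (intro Max_ge) auto
    then have "0 \<le> Max (u ` {..n})" using nonneg[of n] by linarith
    then have "0 \<le> Max (u ` {..n}) / real n" by simp
    ultimately show ?case unfolding dist_real_def using e by linarith
  qed
qed

lemma norm_blinfun_compose_bound:
  assumes "norm X \<le> a" "norm Y \<le> b"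
  shows "norm (X o\<^sub>L Y) \<le> a * b"
  using norm_blinfun_compose[of X Y] mult_mono[OF assms order_trans[OF norm_ge_zero assms(1)] norm_ge_zero]
  by linarith

text \<open>
  Summation by parts in multiplicative form.  With \<open>h = t / n\<close>, \<open>P k\<close> the product of the first \<open>k\<close>
  factors, \<open>Q k = exp ((n - k) h B)\<close> and \<open>D k\<close> the partial sum of the deviations \<open>a i - B\<close>, the operators
  \<open>R k = P k (1 - h D k) Q k\<close> lead from \<open>R 0 = exp (t B)\<close> to \<open>R n = P n (1 - h D n)\<close>.  The correction \<open>h D k\<close>
  grows by exactly the first-order error \<open>h (a (k + 1) - B)\<close> made in passing from \<open>k\<close> to
  \<open>k + 1\<close>, so only terms of size \<open>h\<^sup>2 (1 + \<parallel>D\<parallel>)\<close> remain in each increment of \<open>R\<close>.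
\<close>
lemma op_prod_exp_error:
  fixes a :: "nat \<Rightarrow> 'a::banach \<Rightarrow>\<^sub>L 'a"
  assumes a: "\<And>k. 1 \<le> k \<Longrightarrow> norm (a k) \<le> c" and B: "norm B \<le> c"
    and t: "0 \<le> t" "t \<le> T" and n: "0 < n"
    and dev: "\<And>j. j \<le> n \<Longrightarrow> norm (\<Sum>i=1..j. a i - B) \<le> \<eta> * real n"
  defines "K \<equiv> exp (T * c)"
  shows "norm (op_prod (\<lambda>k. op_exp ((t / real n) *\<^sub>R a k)) n - op_exp (t *\<^sub>R B))
    \<le> K * T * \<eta> + 2 * c * K\<^sup>2 * T\<^sup>2 * \<eta> + c\<^sup>2 * K\<^sup>2 * (K + 1) * T\<^sup>2 * (1 + T * \<eta>) / real n"
proof -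
  define h where "h = t / real n"
  define P where "P = op_prod (\<lambda>k. op_exp (h *\<^sub>R a k))"
  define D where "D j = (\<Sum>i=1..j. a i - B)" for j
  define Q where "Q k = op_exp ((real (n - k) * h) *\<^sub>R B)" for k
  define R where "R k = P k o\<^sub>L ((id_blinfun - h *\<^sub>R D k) o\<^sub>L Q k)" for k
  define \<delta> where "\<delta> = \<eta> * real n"
  \<comment> \<open>\<open>\<gamma>\<close> bounds the second-order remainder of each exponential over a step of length \<open>h\<close>\<close>
  define \<gamma> where "\<gamma> = (h * c)\<^sup>2 * K"
  have c: "0 \<le> c" using B norm_ge_zero order_trans by blast
  have T: "0 \<le> T" using t by simp
  have K: "1 \<le> K" using c T by (simp add: K_def)
  have h: "0 \<le> h" using t by (simp add: h_def)
  have hn: "h * real n \<le> T" using t n by (simp add: h_def)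
  have hk: "h * real k \<le> T" if "k \<le> n" for k
    using hn mult_left_mono[of "real k" "real n" h] that h by simp
  have exp_le_K: "exp (h * real k * c) \<le> K" if "k \<le> n" for k
    using mult_right_mono[OF hk[OF that] c] by (simp add: K_def)
  have \<delta>: "norm (D j) \<le> \<delta>" if "j \<le> n" for j
    using dev[OF that] by (simp add: D_def \<delta>_def)
  have \<delta>0: "0 \<le> \<delta>" using \<delta>[of 0] by (simp add: D_def)
  have \<gamma>0: "0 \<le> \<gamma>" using K by (simp add: \<gamma>_def)
  have normP: "norm (P k) \<le> K" if "k \<le> n" for k
  proof -
    have "norm (P k) \<le> exp (h * c) ^ k"
      unfolding P_def by (rule norm_op_prod_le) (auto intro!: norm_op_exp_le a h)
    also have "\<dots> = exp (h * real k * c)" by (simp add: exp_of_nat_mult[symmetric] mult_ac)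
    finally show ?thesis using exp_le_K[OF that] by linarith
  qed
  have normQ: "norm (Q k) \<le> K" for k
  proof -
    have "norm (Q k) \<le> exp (real (n - k) * h * c)"
      unfolding Q_def by (rule norm_op_exp_le[OF B]) (use h in simp)
    then show ?thesis using exp_le_K[of "n - k"] by (simp add: mult_ac)
  qed
  have norm_corr: "norm (id_blinfun - h *\<^sub>R D j) \<le> 1 + h * \<delta>" if "j \<le> n" for j
  proof -
    have "norm (h *\<^sub>R D j) \<le> h * \<delta>" using \<delta>[OF that] h by (simp add: mult_left_mono)
    then show ?thesis
      using norm_triangle_ineq4[of id_blinfun "h *\<^sub>R D j"] norm_id_blinfun_le[where 'a = 'a] by linarith
  qed
  have step: "norm (R (Suc k) - R k) \<le> K * (h\<^sup>2 * (2 * c * \<delta>) * K + (1 + h * \<delta>) * \<gamma> * (K + 1))"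
    if k: "k < n" for k
  proof -
    define X where "X = a (Suc k)"
    have X: "norm X \<le> c" by (simp add: X_def a)
    define e where "e = op_exp (h *\<^sub>R X) - (id_blinfun + h *\<^sub>R X)"
    define q where "q = Q k - ((id_blinfun + h *\<^sub>R B) o\<^sub>L Q (Suc k))"
    have e: "norm e \<le> \<gamma>"
    proof -
      have "norm e \<le> (h * c)\<^sup>2 * exp (h * c)"
        using op_exp_step_error[OF X order_refl h] by (simp add: e_def op_exp_zero blinfun_compose_id)
      also have "\<dots> \<le> \<gamma>"
        unfolding \<gamma>_def using exp_le_K[of 1] n by (intro mult_left_mono) auto
      finally show ?thesis .
    qed
    have q: "norm q \<le> \<gamma>"
    proof -
      have nk: "real (n - k) * h = real (n - Suc k) * h + h"
        using k by (simp add: Suc_diff_Suc[symmetric] algebra_simps del: Suc_diff_Suc)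
      have "norm q \<le> (h * c)\<^sup>2 * exp (real (n - k) * h * c)"
        unfolding q_def Q_def nk by (rule op_exp_step_error[OF B _ h]) (use h in simp)
      also have "\<dots> \<le> \<gamma>"
        unfolding \<gamma>_def using exp_le_K[of "n - k"] by (intro mult_left_mono) (auto simp: mult_ac)
      finally show ?thesis .
    qed
    \<comment> \<open>the terms of order \<open>0\<close> and \<open>1\<close> in \<open>h\<close> cancel because \<open>D (k + 1) - D k = X - B\<close>\<close>
    define G where "G = (- h\<^sup>2) *\<^sub>R (((X o\<^sub>L D (Suc k)) - (D k o\<^sub>L B)) o\<^sub>L Q (Suc k))
      + ((e o\<^sub>L ((id_blinfun - h *\<^sub>R D (Suc k)) o\<^sub>L Q (Suc k))) - ((id_blinfun - h *\<^sub>R D k) o\<^sub>L q))"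
    have E: "op_exp (h *\<^sub>R X) = id_blinfun + h *\<^sub>R X + e" by (simp add: e_def)
    have Qk: "Q k = ((id_blinfun + h *\<^sub>R B) o\<^sub>L Q (Suc k)) + q" by (simp add: q_def)
    have DS: "D (Suc k) = D k + (X - B)" by (simp add: D_def X_def)
    have PS: "P (Suc k) = P k o\<^sub>L op_exp (h *\<^sub>R X)" by (simp add: P_def op_prod_Suc X_def)
    have "R (Suc k) - R k = P k o\<^sub>L G"
      unfolding R_def G_def PS E Qk DS
      by (intro blinfun_eqI) (simp add: blinfun.bilinear_simps algebra_simps power2_eq_square)
    moreover have "norm G \<le> h\<^sup>2 * (2 * c * \<delta>) * K + (1 + h * \<delta>) * \<gamma> * (K + 1)"
    proof -
      have "norm ((X o\<^sub>L D (Suc k)) - (D k o\<^sub>L B)) \<le> c * \<delta> + \<delta> * c"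
        using k by (intro norm_triangle_le_diff add_mono norm_blinfun_compose_bound X B \<delta>) auto
      from norm_blinfun_compose_bound[OF this normQ[of "Suc k"]]
      have 1: "norm ((- h\<^sup>2) *\<^sub>R (((X o\<^sub>L D (Suc k)) - (D k o\<^sub>L B)) o\<^sub>L Q (Suc k))) \<le> h\<^sup>2 * ((c * \<delta> + \<delta> * c) * K)"
        by (simp add: mult_left_mono)
      have 2: "norm (e o\<^sub>L ((id_blinfun - h *\<^sub>R D (Suc k)) o\<^sub>L Q (Suc k))) \<le> \<gamma> * ((1 + h * \<delta>) * K)"
        using k by (intro norm_blinfun_compose_bound e norm_corr normQ) auto
      have 3: "norm ((id_blinfun - h *\<^sub>R D k) o\<^sub>L q) \<le> (1 + h * \<delta>) * \<gamma>"
        using k by (intro norm_blinfun_compose_bound q norm_corr) auto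
      have "norm G \<le> h\<^sup>2 * ((c * \<delta> + \<delta> * c) * K) + (\<gamma> * ((1 + h * \<delta>) * K) + (1 + h * \<delta>) * \<gamma>)"
        unfolding G_def by (intro norm_triangle_le norm_triangle_le_diff add_mono 1 2 3)
      then show ?thesis by (simp add: algebra_simps)
    qed
    ultimately show ?thesis
      using norm_blinfun_compose_bound[OF normP[of k]] k by simp
  qed
  have R0: "R 0 = op_exp (t *\<^sub>R B)"
    using n by (simp add: R_def P_def D_def Q_def op_prod_0 blinfun_compose_id h_def)
  have Rn: "R n = P n - (P n o\<^sub>L (h *\<^sub>R D n))"
    by (simp add: R_def Q_def op_exp_zero blinfun_compose_id blinfun_compose_bilinear)
  have "norm (R n - R 0) \<le> real n * (K * (h\<^sup>2 * (2 * c * \<delta>) * K + (1 + h * \<delta>) * \<gamma> * (K + 1)))"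
  proof -
    have "R n - R 0 = (\<Sum>k<n. R (Suc k) - R k)" by (simp add: sum_lessThan_telescope)
    also have "norm \<dots> \<le> (\<Sum>k<n. K * (h\<^sup>2 * (2 * c * \<delta>) * K + (1 + h * \<delta>) * \<gamma> * (K + 1)))"
      by (intro sum_norm_le step) simp
    finally show ?thesis by simp
  qed
  also have "\<dots> = 2 * c * K\<^sup>2 * (h * real n)\<^sup>2 * \<eta> + c\<^sup>2 * K\<^sup>2 * (K + 1) * (h * real n)\<^sup>2 * (1 + (h * real n) * \<eta>) / real n"
    using n by (simp add: \<delta>_def \<gamma>_def field_simps power2_eq_square)
  also have "\<dots> \<le> 2 * c * K\<^sup>2 * T\<^sup>2 * \<eta> + c\<^sup>2 * K\<^sup>2 * (K + 1) * T\<^sup>2 * (1 + T * \<eta>) / real n"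
  proof -
    have \<eta>: "0 \<le> \<eta>" using \<delta>0 n by (simp add: \<delta>_def zero_le_mult_iff)
    have sq: "(h * real n)\<^sup>2 \<le> T\<^sup>2" using hn h by (intro power_mono) auto
    show ?thesis
      using c K \<eta> T h hn sq
      by (intro add_mono mult_mono divide_right_mono mult_left_mono mult_right_mono) auto
  qed
  finally have "norm (R n - R 0) \<le> 2 * c * K\<^sup>2 * T\<^sup>2 * \<eta> + c\<^sup>2 * K\<^sup>2 * (K + 1) * T\<^sup>2 * (1 + T * \<eta>) / real n" .
  moreover have "norm (P n o\<^sub>L (h *\<^sub>R D n)) \<le> K * (T * \<eta>)"
  proof (intro norm_blinfun_compose_bound normP order_refl)
    have "norm (h *\<^sub>R D n) \<le> h * \<delta>" using \<delta>[of n] h by (simp add: mult_left_mono)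
    also have "\<dots> = (h * real n) * \<eta>" by (simp add: \<delta>_def)
    also have "\<dots> \<le> T * \<eta>"
      using hn \<delta>0 n by (intro mult_right_mono) (auto simp: \<delta>_def zero_le_mult_iff)
    finally show "norm (h *\<^sub>R D n) \<le> T * \<eta>" .
  qed
  moreover have "P n - R 0 = (R n - R 0) + (P n o\<^sub>L (h *\<^sub>R D n))"
    by (simp add: Rn)
  then have "norm (P n - R 0) \<le> norm (R n - R 0) + norm (P n o\<^sub>L (h *\<^sub>R D n))"
    by (metis norm_triangle_ineq)
  ultimately show ?thesis
    by (simp add: P_def R0 h_def algebra_simps)
qed

text \<open>
  The error bound of \<open>op_prod_exp_error\<close> does not depend on \<open>t\<close>, and it tends to \<open>0\<close> along
  the sequence \<open>\<eta> n = max\<^sub>k \<parallel>D k\<parallel> / n\<close>, where \<open>k\<close> ranges over \<open>0, \<dots>, n\<close>.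
\<close>
theorem op_prod_exp_uniform_limit:
  fixes a :: "nat \<Rightarrow> 'a::banach \<Rightarrow>\<^sub>L 'a"
  assumes a: "\<And>k. 1 \<le> k \<Longrightarrow> norm (a k) \<le> c"
    and lim: "(\<lambda>n. (1 / real n) *\<^sub>R (\<Sum>k=1..n. a k)) \<longlonglongrightarrow> B"
  shows "uniform_limit {0..T} (\<lambda>n t. op_prod (\<lambda>k. op_exp ((t / real n) *\<^sub>R a k)) n)
    (\<lambda>t. op_exp (t *\<^sub>R B)) sequentially"
proof -
  define b where "b = max c (norm B)"
  define u where "u n = norm (\<Sum>i=1..n. a i - B)" for n
  define \<eta> where "\<eta> n = Max (u ` {..n}) / real n" for n
  define K where "K = exp (T * b)"
  have "(\<lambda>n. u n / real n) \<longlonglongrightarrow> 0"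
  proof (rule Lim_transform_eventually)
    show "(\<lambda>n. norm ((1 / real n) *\<^sub>R (\<Sum>k=1..n. a k) - B)) \<longlonglongrightarrow> 0"
      using tendsto_norm[OF LIM_zero[OF lim]] by simp
    show "eventually (\<lambda>n. norm ((1 / real n) *\<^sub>R (\<Sum>k=1..n. a k) - B) = u n / real n) sequentially"
      using eventually_gt_at_top[of 0]
    proof eventually_elim
      case (elim n)
      have "(1 / real n) *\<^sub>R (\<Sum>k=1..n. a k) - B = (1 / real n) *\<^sub>R (\<Sum>i=1..n. a i - B)"
        using elim by (simp add: sum_subtractf scaleR_diff_right sum_constant_scaleR)
      then show ?case by (simp add: u_def)
    qed
  qed
  then have \<eta>: "\<eta> \<longlonglongrightarrow> 0"
    unfolding \<eta>_def by (intro running_maximum_average_tendsto_zero) (auto simp: u_def)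
  have "(\<lambda>n. b\<^sup>2 * K\<^sup>2 * (K + 1) * T\<^sup>2 * (1 + T * \<eta> n))
      \<longlonglongrightarrow> b\<^sup>2 * K\<^sup>2 * (K + 1) * T\<^sup>2 * (1 + T * 0)"
    by (intro tendsto_intros \<eta>)
  then have rest: "(\<lambda>n. b\<^sup>2 * K\<^sup>2 * (K + 1) * T\<^sup>2 * (1 + T * \<eta> n) / real n) \<longlonglongrightarrow> 0"
    by (rule real_tendsto_divide_at_top[OF _ filterlim_real_sequentially])
  have "(\<lambda>n. K * T * \<eta> n + 2 * b * K\<^sup>2 * T\<^sup>2 * \<eta> n
      + b\<^sup>2 * K\<^sup>2 * (K + 1) * T\<^sup>2 * (1 + T * \<eta> n) / real n)
      \<longlonglongrightarrow> K * T * 0 + 2 * b * K\<^sup>2 * T\<^sup>2 * 0 + 0"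
    by (intro tendsto_add tendsto_mult tendsto_const \<eta> rest)
  then have bound: "(\<lambda>n. K * T * \<eta> n + 2 * b * K\<^sup>2 * T\<^sup>2 * \<eta> n
      + b\<^sup>2 * K\<^sup>2 * (K + 1) * T\<^sup>2 * (1 + T * \<eta> n) / real n) \<longlonglongrightarrow> 0" by simp
  show ?thesis
  proof (rule uniform_limitI)
    fix e :: real assume "0 < e"
    from order_tendstoD(2)[OF bound this] eventually_gt_at_top[of 0]
    show "eventually (\<lambda>n. \<forall>t\<in>{0..T}. dist (op_prod (\<lambda>k. op_exp ((t / real n) *\<^sub>R a k)) n)
        (op_exp (t *\<^sub>R B)) < e) sequentially"
    proof eventually_elim
      case (elim n)
      have "u j \<le> \<eta> n * real n" if "j \<le> n" for j
        using that elim(2) by (simp add: \<eta>_def)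
      then have "norm (op_prod (\<lambda>k. op_exp ((t / real n) *\<^sub>R a k)) n - op_exp (t *\<^sub>R B))
          \<le> K * T * \<eta> n + 2 * b * K\<^sup>2 * T\<^sup>2 * \<eta> n + b\<^sup>2 * K\<^sup>2 * (K + 1) * T\<^sup>2 * (1 + T * \<eta> n) / real n"
        if "t \<in> {0..T}" for t
        unfolding K_def using that elim(2) a
        by (intro op_prod_exp_error) (auto simp: b_def u_def le_max_iff_disj)
      with elim(1) show ?case by (fastforce simp: dist_norm)
    qed
  qed
qed

section \<open>The strong law of large numbers for bounded real variables\<close>

text \<open>
  By Hoeffding's inequality the average over \<open>n\<close> terms deviates from the mean by \<open>\<epsilon>\<close> with probability at
  most \<open>2 q ^ n\<close> for some \<open>q < 1\<close>.  These probabilities are summable, so by Borel--Cantelli almost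
  surely only finitely many averages deviate by \<open>\<epsilon>\<close>; the values \<open>\<epsilon> = 1 / Suc m\<close> suffice.
\<close>
lemma average_tendsto_expectation_AE:
  fixes X :: "nat \<Rightarrow> 'w \<Rightarrow> real"
  assumes "prob_space M" and iid: "iid M X" and bound: "AE \<omega> in M. \<bar>X 0 \<omega>\<bar> \<le> C"
  shows "AE \<omega> in M. (\<lambda>n. (\<Sum>k=1..n. X k \<omega>) / real n) \<longlonglongrightarrow> integral\<^sup>L M (X 0)"
proof -
  interpret prob_space M by fact
  \<comment> \<open>a bound at least \<open>1\<close> gives the interval \<open>{- D..D}\<close> positive length, as Hoeffding's inequality requires\<close>
  define D where "D = max C 1"
  have ind: "indep_vars (\<lambda>_. borel) X UNIV" and dist: "distr M borel (X i) = distr M borel (X j)" for i j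
    using iid by (auto simp: iid_def)
  have rv [measurable]: "random_variable borel (X i)" for i
    using ind by (auto simp: indep_vars_def)
  have H: "Hoeffding_ineq_iid M {1..n} X (X 0) (- D) D" for n
  proof unfold_locales
    show "indep_vars (\<lambda>_. borel) X {1..n}"
      using ind by (rule indep_vars_subset) auto
    show "AE x in M. X 0 x \<in> {- D..D}"
      using bound by eventually_elim (auto simp: D_def)
  qed (auto intro: dist)
  have dev: "AE \<omega> in M. eventually (\<lambda>n. \<bar>(\<Sum>k=1..n. X k \<omega>) / real n - expectation (X 0)\<bar> < \<epsilon>) sequentially"
    if eps: "0 < \<epsilon>" for \<epsilon>
  proof -
    define B where "B n = {\<omega>\<in>space M. \<epsilon> \<le> \<bar>(\<Sum>k=1..n. X k \<omega>) / real n - expectation (X 0)\<bar>}" for n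
    define q where "q = exp (- 2 * \<epsilon>\<^sup>2 / (D - - D)\<^sup>2)"
    have D: "- D < D" by (simp add: D_def)
    have q: "0 < q" "q < 1" using eps D by (auto simp: q_def)
    have bound_B: "measure M (B n) \<le> 2 * q ^ n" if "1 \<le> n" for n
      using Hoeffding_ineq_iid.Hoeffding_ineq_abs_ge'[OF H[of n], of \<epsilon>] eps D that
      by (simp add: B_def q_def exp_of_nat_mult[symmetric] mult_ac)
    have "summable (\<lambda>n. measure M (B n))"
    proof (rule summable_comparison_test')
      show "summable (\<lambda>n. 2 * q ^ n)" using q by (intro summable_mult summable_geometric) auto
      show "norm (measure M (B n)) \<le> 2 * q ^ n" if "1 \<le> n" for n using bound_B[OF that] by simp
    qed
    then have "AE \<omega> in M. eventually (\<lambda>n. \<omega> \<in> space M - B n) sequentially"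
      by (intro borel_cantelli_AE1) (auto simp: B_def less_top[symmetric])
    then show ?thesis
      by eventually_elim (auto simp: B_def not_le elim!: eventually_mono)
  qed
  have "AE \<omega> in M. \<forall>m::nat. eventually (\<lambda>n. \<bar>(\<Sum>k=1..n. X k \<omega>) / real n - expectation (X 0)\<bar> < 1 / Suc m) sequentially"
    unfolding AE_all_countable by (intro allI dev) simp
  then show ?thesis
  proof eventually_elim
    case (elim \<omega>)
    show ?case
    proof (rule tendstoI)
      fix e :: real assume "0 < e"
      then obtain m where "1 / Suc m < e" using nat_approx_posE by blast
      with elim[rule_format, of m] show "eventually (\<lambda>n. dist ((\<Sum>k=1..n. X k \<omega>) / real n) (expectation (X 0)) < e) sequentially"
        by (auto simp: dist_real_def elim!: eventually_mono)
    qed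
  qed
qed

section \<open>Bochner integrals and approximation by simple functions\<close>

text \<open>
  In a space that is not separable the difference of two Borel functions need not be measurable.
  Subtracting a function of finitely many values is harmless: on each of its level sets
  only a constant is subtracted.
\<close>
lemma borel_measurable_norm_diff_simple:
  fixes f :: "'w \<Rightarrow> 'b::real_normed_vector"
  assumes f [measurable]: "f \<in> borel_measurable M" and s: "simple_function M s"
  shows "(\<lambda>\<omega>. norm (f \<omega> - s \<omega>)) \<in> borel_measurable M"
proof (rule measurable_compose_countable'[where g = s and I = "s ` space M"])
  show "countable (s ` space M)" and "s \<in> measurable M (count_space (s ` space M))"
    using s measurable_simple_function[OF s]
    by (auto simp: simple_function_def countable_finite measurable_count_space_eq2)
  show "(\<lambda>\<omega>. norm (f \<omega> - i)) \<in> borel_measurable M" for i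
    by (rule measurable_compose[OF f, of "\<lambda>y. norm (y - i)"])
      (intro borel_measurable_continuous_onI continuous_intros)
qed

lemma simple_bochner_integral_dist_le:
  fixes f :: "'w \<Rightarrow> 'b::real_normed_vector"
  assumes f: "f \<in> borel_measurable M"
    and s: "Bochner_Integration.simple_bochner_integrable M s"
    and t: "Bochner_Integration.simple_bochner_integrable M t"
  shows "ennreal (dist (Bochner_Integration.simple_bochner_integral M s)
      (Bochner_Integration.simple_bochner_integral M t)) \<le>
    (\<integral>\<^sup>+\<omega>. ennreal (norm (f \<omega> - s \<omega>)) \<partial>M) + (\<integral>\<^sup>+\<omega>. ennreal (norm (f \<omega> - t \<omega>)) \<partial>M)"
proof -
  have sf: "simple_function M s" "simple_function M t"
    using s t by (auto elim: simple_bochner_integrable.cases)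
  note [measurable] = borel_measurable_norm_diff_simple[OF f sf(1)]
    borel_measurable_norm_diff_simple[OF f sf(2)]
  have st: "Bochner_Integration.simple_bochner_integrable M (\<lambda>\<omega>. s \<omega> - t \<omega>)"
    using simple_bochner_integrable_compose2[of "(-)", OF _ s t] by simp
  have nst: "Bochner_Integration.simple_bochner_integrable M (\<lambda>\<omega>. norm (s \<omega> - t \<omega>))"
    using simple_bochner_integrable_compose2[of "\<lambda>x y. norm (x - y)", OF _ s t] by simp
  have "dist (Bochner_Integration.simple_bochner_integral M s)
      (Bochner_Integration.simple_bochner_integral M t)
      \<le> Bochner_Integration.simple_bochner_integral M (\<lambda>\<omega>. norm (s \<omega> - t \<omega>))"
    using simple_bochner_integral_norm_bound[OF st] simple_bochner_integral_diff[OF s t]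
    by (simp add: dist_norm)
  then have "ennreal (dist (Bochner_Integration.simple_bochner_integral M s)
      (Bochner_Integration.simple_bochner_integral M t))
      \<le> (\<integral>\<^sup>+\<omega>. ennreal (norm (s \<omega> - t \<omega>)) \<partial>M)"
    using simple_bochner_integral_eq_nn_integral[OF nst] by (metis ennreal_leI norm_ge_zero)
  also have "\<dots> \<le> (\<integral>\<^sup>+\<omega>. ennreal (norm (f \<omega> - s \<omega>)) + ennreal (norm (f \<omega> - t \<omega>)) \<partial>M)"
  proof (rule nn_integral_mono)
    fix \<omega>
    have "norm (s \<omega> - t \<omega>) \<le> norm (f \<omega> - s \<omega>) + norm (f \<omega> - t \<omega>)"
      using norm_triangle_ineq4[of "f \<omega> - t \<omega>" "f \<omega> - s \<omega>"] by (simp add: algebra_simps)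
    then show "ennreal (norm (s \<omega> - t \<omega>)) \<le> ennreal (norm (f \<omega> - s \<omega>)) + ennreal (norm (f \<omega> - t \<omega>))"
      by (simp flip: ennreal_plus add: ennreal_leI)
  qed
  also have "\<dots> = (\<integral>\<^sup>+\<omega>. ennreal (norm (f \<omega> - s \<omega>)) \<partial>M) + (\<integral>\<^sup>+\<omega>. ennreal (norm (f \<omega> - t \<omega>)) \<partial>M)"
    by (rule nn_integral_add) measurable
  finally show ?thesis .
qed

lemma has_bochner_int_unique:
  fixes f :: "'w \<Rightarrow> 'b::real_normed_vector"
  assumes f: "f \<in> borel_measurable M" and "has_bochner_int M f v" and "has_bochner_int M f w"
  shows "v = w"
proof -
  let ?E = "\<lambda>s. \<integral>\<^sup>+\<omega>. ennreal (norm (f \<omega> - s \<omega>)) \<partial>M"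
  obtain s t where s: "\<And>i::nat. Bochner_Integration.simple_bochner_integrable M (s i)"
      "(\<lambda>i. ?E (s i)) \<longlonglongrightarrow> 0" "(\<lambda>i. Bochner_Integration.simple_bochner_integral M (s i)) \<longlonglongrightarrow> v"
    and t: "\<And>i::nat. Bochner_Integration.simple_bochner_integrable M (t i)"
      "(\<lambda>i. ?E (t i)) \<longlonglongrightarrow> 0" "(\<lambda>i. Bochner_Integration.simple_bochner_integral M (t i)) \<longlonglongrightarrow> w"
    using assms(2,3) unfolding has_bochner_int_def by auto
  have "(\<lambda>i. ennreal (dist (Bochner_Integration.simple_bochner_integral M (s i))
      (Bochner_Integration.simple_bochner_integral M (t i)))) \<longlonglongrightarrow> 0"
  proof (rule tendsto_sandwich[OF _ _ tendsto_const])
    show "(\<lambda>i. ?E (s i) + ?E (t i)) \<longlonglongrightarrow> 0"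
      using tendsto_add[OF s(2) t(2)] by simp
  qed (auto intro!: always_eventually simple_bochner_integral_dist_le[OF f s(1) t(1)])
  moreover have "(\<lambda>i. ennreal (dist (Bochner_Integration.simple_bochner_integral M (s i))
      (Bochner_Integration.simple_bochner_integral M (t i)))) \<longlonglongrightarrow> ennreal (dist v w)"
    by (intro tendsto_ennrealI tendsto_dist s(3) t(3))
  ultimately have "ennreal (dist v w) = 0"
    by (rule LIMSEQ_unique[rotated])
  then show ?thesis by (simp add: ennreal_eq_0_iff)
qed

text \<open>
  For simple functions tending to \<open>f\<close> in mean, the integrals form a Cauchy sequence by
  \<open>simple_bochner_integral_dist_le\<close>.  Its limit meets the definition of the Bochner
  integral of \<open>f\<close>, and uniqueness identifies it with \<open>bochner_int M f\<close>.
\<close>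
lemma has_bochner_int_limit:
  fixes f :: "'w \<Rightarrow> 'b::banach"
  assumes f: "f \<in> borel_measurable M" and bm: "bochner_measurable M f"
    and s: "\<And>i. Bochner_Integration.simple_bochner_integrable M (s i)"
    and lim: "(\<lambda>i::nat. \<integral>\<^sup>+\<omega>. ennreal (norm (f \<omega> - s i \<omega>)) \<partial>M) \<longlonglongrightarrow> 0"
  shows "(\<lambda>i. Bochner_Integration.simple_bochner_integral M (s i)) \<longlonglongrightarrow> bochner_int M f"
proof -
  let ?E = "\<lambda>i. \<integral>\<^sup>+\<omega>. ennreal (norm (f \<omega> - s i \<omega>)) \<partial>M"
  let ?I = "\<lambda>i. Bochner_Integration.simple_bochner_integral M (s i)"
  have "Cauchy ?I"
  proof (rule metric_CauchyI)
    fix e :: real assume e: "0 < e"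
    then have "eventually (\<lambda>i. ?E i < ennreal (e / 2)) sequentially"
      using order_tendstoD(2)[OF lim, of "ennreal (e / 2)"] by simp
    then obtain N where N: "\<And>i. N \<le> i \<Longrightarrow> ?E i < ennreal (e / 2)"
      by (auto simp: eventually_sequentially)
    show "\<exists>N. \<forall>m\<ge>N. \<forall>n\<ge>N. dist (?I m) (?I n) < e"
    proof (intro exI[of _ N] allI impI)
      fix m n assume mn: "N \<le> m" "N \<le> n"
      have "ennreal (dist (?I m) (?I n)) \<le> ?E m + ?E n"
        by (rule simple_bochner_integral_dist_le[OF f s s])
      also have "\<dots> < ennreal (e / 2) + ennreal (e / 2)"
        by (intro add_strict_mono N mn)
      also have "\<dots> = ennreal e"
        using e by (simp flip: ennreal_plus)
      finally show "dist (?I m) (?I n) < e"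
        using e by (simp add: ennreal_less_iff)
    qed
  qed
  then obtain v where v: "?I \<longlonglongrightarrow> v"
    by (auto simp: Cauchy_convergent_iff convergent_def)
  then have "has_bochner_int M f v"
    using bm s lim by (auto simp: has_bochner_int_def)
  then have "bochner_int M f = v"
    unfolding bochner_int_def using has_bochner_int_unique[OF f] by blast
  with v show ?thesis by simp
qed

text \<open>
  The first point of the list within distance \<open>\<epsilon>\<close> of \<open>a\<close>, with \<open>0\<close> as the default.  Taking the first such
  point makes the choice Borel measurable, and the default \<open>0\<close> keeps the distance to \<open>a\<close> bounded by
  \<open>max \<epsilon> \<parallel>a\<parallel>\<close> where no listed point is near.
\<close>
primrec nearby_point :: "real \<Rightarrow> 'b::real_normed_vector list \<Rightarrow> 'b \<Rightarrow> 'b" where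
  "nearby_point \<epsilon> [] a = 0"
| "nearby_point \<epsilon> (d # ds) a = (if dist a d < \<epsilon> then d else nearby_point \<epsilon> ds a)"

lemma simple_function_nearby_point: "simple_function borel (nearby_point \<epsilon> ds)"
proof (induction ds)
  case (Cons d ds)
  have "open {a. dist a d < \<epsilon>}"
    by (intro open_Collect_less continuous_intros)
  then show ?case
    using Cons by (auto intro!: simple_function_If simp: nearby_point.simps[abs_def] borel_open)
qed (simp add: nearby_point.simps[abs_def])

lemma norm_diff_nearby_point_less:
  "\<exists>d\<in>set ds. dist a d < \<epsilon> \<Longrightarrow> norm (a - nearby_point \<epsilon> ds a) < \<epsilon>"
  by (induction ds) (auto simp: dist_norm)

lemma norm_diff_nearby_point_le: "norm (a - nearby_point \<epsilon> ds a) \<le> max \<epsilon> (norm a)"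
  by (induction ds) (auto simp: dist_norm)

text \<open>
  The values of the simple functions converging to \<open>X\<close> form a countable set that comes arbitrarily
  close to almost every value of \<open>X\<close>.  Finitely many of these points \<open>\<delta>\<close>-approximate \<open>X\<close> outside an event \<open>bad N\<close> of
  small probability, and on \<open>bad N\<close> the error is still bounded.  The approximation is a function of the
  value of \<open>X\<close> rather than of the outcome, so it can be applied to every copy of \<open>X\<close> in an
  i.i.d. sequence.
\<close>
lemma simple_approximation:
  fixes X :: "'w \<Rightarrow> 'b::real_normed_vector"
  assumes "prob_space M" and X [measurable]: "X \<in> borel_measurable M"
    and bm: "bochner_measurable M X" and bound: "AE \<omega> in M. norm (X \<omega>) \<le> C" and eps: "0 < \<epsilon>"
  shows "\<exists>g. simple_function borel g \<and> (\<forall>a. norm (a - g a) \<le> max \<epsilon> (norm a)) \<and>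
    (\<integral>\<omega>. norm (X \<omega> - g (X \<omega>)) \<partial>M) \<le> \<epsilon>"
proof -
  interpret prob_space M by fact
  obtain s where s: "\<And>i::nat. simple_function M (s i)" and lim: "AE \<omega> in M. (\<lambda>i. s i \<omega>) \<longlonglongrightarrow> X \<omega>"
    using bm by (auto simp: bochner_measurable_def)
  have "countable (\<Union>i. s i ` space M)"
    using s by (auto simp: simple_function_def intro: countable_finite)
  moreover have "(\<Union>i. s i ` space M) \<noteq> {}" using not_empty by auto
  ultimately obtain d :: "nat \<Rightarrow> 'b" where d: "range d = (\<Union>i. s i ` space M)"
    by (metis range_from_nat_into)
  define \<delta> where "\<delta> = \<epsilon> / 2"
  have \<delta>: "0 < \<delta>" using eps by (simp add: \<delta>_def)
  define K where "K = max \<delta> C"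
  have K: "0 < K" using \<delta> by (auto simp: K_def)
  define bad where "bad N = {\<omega>\<in>space M. \<forall>j<N. \<delta> \<le> dist (X \<omega>) (d j)}" for N
  have bad [measurable]: "bad N \<in> sets M" for N
  proof -
    have "Measurable.pred M (\<lambda>\<omega>. \<delta> \<le> dist (X \<omega>) (d j))" for j
    proof -
      have "(\<lambda>\<omega>. dist (X \<omega>) (d j)) \<in> borel_measurable M"
        by (rule measurable_compose[OF X, of "\<lambda>y. dist y (d j)"])
          (intro borel_measurable_continuous_onI continuous_intros)
      then show ?thesis by measurable
    qed
    then show ?thesis unfolding bad_def by measurable
  qed
  have near: "AE \<omega> in M. \<exists>j. dist (X \<omega>) (d j) < \<delta>"
    using lim AE_space
  proof eventually_elim
    case (elim \<omega>)
    from tendstoD[OF elim(1) \<delta>] obtain i where "dist (s i \<omega>) (X \<omega>) < \<delta>"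
      by (auto simp: eventually_sequentially)
    moreover have "s i \<omega> \<in> range d" using d elim(2) by auto
    ultimately show ?case by (auto simp: dist_commute)
  qed
  have "(\<lambda>N. prob (bad N)) \<longlonglongrightarrow> prob (\<Inter>N. bad N)"
  proof (rule finite_Lim_measure_decseq)
    show "range bad \<subseteq> events" using bad by blast
    show "decseq bad" unfolding decseq_def bad_def by fastforce
  qed
  moreover have "prob (\<Inter>N. bad N) = 0"
  proof (subst prob_eq_0)
    show "AE \<omega> in M. \<omega> \<notin> (\<Inter>N. bad N)"
      using near
    proof eventually_elim
      case (elim \<omega>)
      then obtain j where "dist (X \<omega>) (d j) < \<delta>" by blast
      then have "\<omega> \<notin> bad (Suc j)" by (auto simp: bad_def not_le)
      then show ?case by blast
    qed
  qed (use bad in blast)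
  ultimately have "(\<lambda>N. prob (bad N)) \<longlonglongrightarrow> 0" by simp
  then have "eventually (\<lambda>N. prob (bad N) < \<delta> / K) sequentially"
    using \<delta> K by (intro order_tendstoD) auto
  then obtain N where N: "prob (bad N) < \<delta> / K"
    by (auto simp: eventually_sequentially)
  define g where "g = nearby_point \<delta> (map d [0..<N])"
  have "simple_function M (\<lambda>\<omega>. g (X \<omega>))"
    using simple_function_comp[OF X simple_function_nearby_point] by (simp add: g_def o_def)
  from borel_measurable_norm_diff_simple[OF X this]
  have meas [measurable]: "(\<lambda>\<omega>. norm (X \<omega> - g (X \<omega>))) \<in> borel_measurable M" .
  have int_bad: "integrable M (\<lambda>\<omega>. K * indicator (bad N) \<omega>)"
    by (intro integrable_mult_right integrable_real_indicator bad) (simp add: less_top[symmetric])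
  have "(\<integral>\<omega>. norm (X \<omega> - g (X \<omega>)) \<partial>M) \<le> (\<integral>\<omega>. \<delta> + K * indicator (bad N) \<omega> \<partial>M)"
  proof (rule integral_mono_AE)
    have le_K: "AE \<omega> in M. norm (X \<omega> - g (X \<omega>)) \<le> K"
      using bound
    proof eventually_elim
      case (elim \<omega>)
      then show ?case
        using norm_diff_nearby_point_le[of "X \<omega>" \<delta> "map d [0..<N]"] by (auto simp: g_def K_def)
    qed
    then show "integrable M (\<lambda>\<omega>. norm (X \<omega> - g (X \<omega>)))"
      by (intro integrable_const_bound[where B = K]) auto
    show "AE \<omega> in M. norm (X \<omega> - g (X \<omega>)) \<le> \<delta> + K * indicator (bad N) \<omega>"
      using le_K AE_space
    proof eventually_elim
      case (elim \<omega>)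
      show ?case
      proof (cases "\<omega> \<in> bad N")
        case True
        with elim \<delta> show ?thesis by simp
      next
        case False
        with elim have "\<exists>y\<in>set (map d [0..<N]). dist (X \<omega>) y < \<delta>"
          by (auto simp: bad_def not_le)
        from norm_diff_nearby_point_less[OF this] False show ?thesis by (simp add: g_def)
      qed
    qed
    show "integrable M (\<lambda>\<omega>. \<delta> + K * indicator (bad N) \<omega>)"
      using int_bad by simp
  qed
  also have "\<dots> = \<delta> + K * prob (bad N)"
    using int_bad by (simp add: prob_space sets.Int_space_eq2[OF bad])
  also have "\<dots> \<le> \<epsilon>"
    using N K by (simp add: \<delta>_def field_simps)
  finally have "(\<integral>\<omega>. norm (X \<omega> - g (X \<omega>)) \<partial>M) \<le> \<epsilon>" .
  moreover have "norm (a - g a) \<le> max \<epsilon> (norm a)" for a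
  proof -
    have "norm (a - g a) \<le> max \<delta> (norm a)"
      unfolding g_def by (rule norm_diff_nearby_point_le)
    also have "\<dots> \<le> max \<epsilon> (norm a)"
      using eps by (intro max.mono) (auto simp: \<delta>_def)
    finally show ?thesis .
  qed
  moreover have "simple_function borel g"
    unfolding g_def by (rule simple_function_nearby_point)
  ultimately show ?thesis by blast
qed

section \<open>The strong law of large numbers in a Banach space\<close>

lemma iid_compose:
  assumes "prob_space M" and iid: "iid M Z" and h [measurable]: "h \<in> borel \<rightarrow>\<^sub>M borel"
  shows "iid M (\<lambda>k \<omega>. h (Z k \<omega>))"
proof -
  interpret prob_space M by fact
  have ind: "indep_vars (\<lambda>_. borel) Z UNIV" and dist: "distr M borel (Z i) = distr M borel (Z j)" for i j
    using iid by (auto simp: iid_def)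
  have rv [measurable]: "Z i \<in> M \<rightarrow>\<^sub>M borel" for i
    using ind by (auto simp: indep_vars_def)
  have "distr M borel (\<lambda>\<omega>. h (Z i \<omega>)) = distr (distr M borel (Z i)) borel h" for i
    by (simp add: distr_distr o_def)
  then have "distr M borel (\<lambda>\<omega>. h (Z i \<omega>)) = distr M borel (\<lambda>\<omega>. h (Z j \<omega>))" for i j
    by (simp only: dist[of i j])
  moreover have "indep_vars (\<lambda>_. borel) (\<lambda>k \<omega>. h (Z k \<omega>)) UNIV"
    by (rule indep_vars_compose2[OF ind h])
  ultimately show ?thesis
    unfolding iid_def by blast
qed

text \<open>
  Since \<open>g\<close> takes finitely many values, the average is the sum of these values weighted by
  their empirical frequencies, which converge to the probabilities by the real strong law.
\<close>
lemma average_simple_tendsto_AE: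
  fixes g :: "'b::topological_space \<Rightarrow> 'c::real_normed_vector"
  assumes "prob_space M" and iid: "iid M Z" and g: "simple_function borel g"
  shows "AE \<omega> in M. (\<lambda>n. (1 / real n) *\<^sub>R (\<Sum>k=1..n. g (Z k \<omega>)))
    \<longlonglongrightarrow> Bochner_Integration.simple_bochner_integral M (\<lambda>\<omega>. g (Z 0 \<omega>))"
proof -
  interpret prob_space M by fact
  have rv [measurable]: "Z i \<in> M \<rightarrow>\<^sub>M borel" for i
    using iid by (auto simp: iid_def indep_vars_def)
  have fin: "finite (range g)" using g by (simp add: simple_function_def)
  define p where "p y = measure M {\<omega>\<in>space M. g (Z 0 \<omega>) = y}" for y
  have freq: "AE \<omega> in M. (\<lambda>n. (\<Sum>k=1..n. indicator (g -` {y}) (Z k \<omega>)) / real n) \<longlonglongrightarrow> p y"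
    if "y \<in> range g" for y
  proof -
    have S: "g -` {y} \<in> sets borel" using g that by (auto simp: simple_function_def)
    have ind: "(indicator (g -` {y}) :: 'b \<Rightarrow> real) \<in> borel \<rightarrow>\<^sub>M borel"
      using S by measurable
    have "(\<lambda>\<omega>. indicator (g -` {y}) (Z 0 \<omega>) :: real)
        = indicator ((\<lambda>\<omega>. Z 0 \<omega>) -` (g -` {y}))"
      by (auto simp: indicator_def)
    then have "(\<integral>\<omega>. indicator (g -` {y}) (Z 0 \<omega>) \<partial>M) = measure M (Z 0 -` (g -` {y}) \<inter> space M)"
      by simp
    also have "\<dots> = p y" unfolding p_def by (rule arg_cong[where f = "measure M"]) auto
    finally have "(\<integral>\<omega>. indicator (g -` {y}) (Z 0 \<omega>) \<partial>M) = p y" .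
    moreover have "AE \<omega> in M. (\<lambda>n. (\<Sum>k=1..n. indicator (g -` {y}) (Z k \<omega>)) / real n)
        \<longlonglongrightarrow> (\<integral>\<omega>. indicator (g -` {y}) (Z 0 \<omega>) \<partial>M)"
      by (rule average_tendsto_expectation_AE[OF prob_space_axioms iid_compose[OF prob_space_axioms iid ind], where C = 1])
        (simp add: indicator_def)
    ultimately show ?thesis by simp
  qed
  have int: "Bochner_Integration.simple_bochner_integral M (\<lambda>\<omega>. g (Z 0 \<omega>)) = (\<Sum>y\<in>range g. p y *\<^sub>R y)"
    unfolding simple_bochner_integral_def p_def
  proof (rule sum.mono_neutral_left[OF fin])
    show "\<forall>y\<in>range g - (\<lambda>\<omega>. g (Z 0 \<omega>)) ` space M. measure M {\<omega>\<in>space M. g (Z 0 \<omega>) = y} *\<^sub>R y = 0"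
    proof
      fix y assume "y \<in> range g - (\<lambda>\<omega>. g (Z 0 \<omega>)) ` space M"
      then have "{\<omega>\<in>space M. g (Z 0 \<omega>) = y} = {}" by blast
      then show "measure M {\<omega>\<in>space M. g (Z 0 \<omega>) = y} *\<^sub>R y = 0" by (simp only: measure_empty) simp
    qed
  qed auto
  have "AE \<omega> in M. \<forall>y\<in>range g. (\<lambda>n. (\<Sum>k=1..n. indicator (g -` {y}) (Z k \<omega>)) / real n) \<longlonglongrightarrow> p y"
    using freq by (intro AE_finite_allI[OF fin])
  then show ?thesis
  proof eventually_elim
    case (elim \<omega>)
    have "(\<lambda>n. \<Sum>y\<in>range g. ((\<Sum>k=1..n. indicator (g -` {y}) (Z k \<omega>)) / real n) *\<^sub>R y)
        \<longlonglongrightarrow> (\<Sum>y\<in>range g. p y *\<^sub>R y)"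
      using elim by (intro tendsto_sum tendsto_scaleR tendsto_const) auto
    moreover have "(\<Sum>y\<in>range g. ((\<Sum>k=1..n. indicator (g -` {y}) (Z k \<omega>)) / real n) *\<^sub>R y)
        = (1 / real n) *\<^sub>R (\<Sum>k=1..n. g (Z k \<omega>))" for n
    proof -
      have g_eq: "g a = (\<Sum>y\<in>range g. indicator (g -` {y}) a *\<^sub>R y)" for a
      proof -
        have "(\<Sum>y\<in>range g. indicator (g -` {y}) a *\<^sub>R y) = (\<Sum>y\<in>range g. if y = g a then y else 0)"
          by (intro sum.cong) (auto simp: indicator_def)
        then show ?thesis using fin by simp
      qed
      have "(\<Sum>k=1..n. g (Z k \<omega>)) = (\<Sum>k=1..n. \<Sum>y\<in>range g. indicator (g -` {y}) (Z k \<omega>) *\<^sub>R y)"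
        by (intro sum.cong refl g_eq)
      also have "\<dots> = (\<Sum>y\<in>range g. (\<Sum>k=1..n. indicator (g -` {y}) (Z k \<omega>)) *\<^sub>R y)"
        by (subst sum.swap) (simp add: scaleR_sum_left)
      finally show ?thesis by (simp add: scaleR_sum_right)
    qed
    ultimately show ?case by (simp add: int)
  qed
qed

text \<open>
  The \<open>\<epsilon>/3\<close> argument that transfers convergence from the averages of simple approximations to the
  averages themselves; \<open>r i\<close> bounds the error of the \<open>i\<close>-th approximation, with limit \<open>\<rho> i\<close>.
\<close>
lemma tendsto_by_approximations:
  fixes a :: "nat \<Rightarrow> 'b::metric_space"
  assumes b: "\<And>i. b i \<longlonglongrightarrow> l i" and r: "\<And>i. r i \<longlonglongrightarrow> \<rho> i"
    and close: "\<And>i n. dist (a n) (b i n) \<le> r i n"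
    and \<rho>: "\<rho> \<longlonglongrightarrow> 0" and l: "l \<longlonglongrightarrow> v"
  shows "a \<longlonglongrightarrow> v"
proof (rule tendstoI)
  fix e :: real assume e: "0 < e"
  have "eventually (\<lambda>i. \<rho> i < e / 3) sequentially"
    using order_tendstoD(2)[OF \<rho>, of "e / 3"] e by simp
  moreover have "eventually (\<lambda>i. dist (l i) v < e / 3) sequentially"
    using tendstoD[OF l, of "e / 3"] e by simp
  ultimately have "eventually (\<lambda>i. \<rho> i < e / 3 \<and> dist (l i) v < e / 3) sequentially"
    by (rule eventually_conj)
  then obtain i where i: "\<rho> i < e / 3" "dist (l i) v < e / 3"
    using eventually_happens'[OF sequentially_bot] by blast
  have "eventually (\<lambda>n. dist (b i n) (l i) < e / 3) sequentially"
    using tendstoD[OF b[of i], of "e / 3"] e by simp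
  with order_tendstoD(2)[OF r[of i] i(1)] show "eventually (\<lambda>n. dist (a n) v < e) sequentially"
  proof eventually_elim
    case (elim n)
    then show ?case
      using close[of n i] i(2) dist_triangle[of "a n" v "l i"] dist_triangle[of "a n" "l i" "b i n"]
      by linarith
  qed
qed

text \<open>
  For simple functions \<open>g i\<close> with \<open>g i (Z 0)\<close> tending to \<open>Z 0\<close> in mean, the averages of \<open>g i (Z k)\<close> converge to
  the integral of \<open>g i (Z 0)\<close>, and the averages of the errors \<open>\<parallel>Z k - g i (Z k)\<parallel>\<close> converge to their mean, a real
  strong law again.  Almost surely this holds for all \<open>i\<close> at once, and letting \<open>i\<close> tend to
  infinity gives the claim.
\<close>
theorem average_tendsto_bochner_int_AE:
  fixes Z :: "nat \<Rightarrow> 'w \<Rightarrow> 'b::banach"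
  assumes "prob_space M" and iid: "iid M Z" and bm: "bochner_measurable M (Z 0)"
    and bound: "AE \<omega> in M. norm (Z 0 \<omega>) \<le> C"
  shows "AE \<omega> in M. (\<lambda>n. (1 / real n) *\<^sub>R (\<Sum>k=1..n. Z k \<omega>)) \<longlonglongrightarrow> bochner_int M (Z 0)"
proof -
  interpret prob_space M by fact
  have rv [measurable]: "Z i \<in> M \<rightarrow>\<^sub>M borel" for i
    using iid by (auto simp: iid_def indep_vars_def)
  have "\<exists>g. simple_function borel g \<and> (\<forall>a. norm (a - g a) \<le> max (1 / real (Suc i)) (norm a)) \<and>
      (\<integral>\<omega>. norm (Z 0 \<omega> - g (Z 0 \<omega>)) \<partial>M) \<le> 1 / real (Suc i)" for i :: nat
    by (rule simple_approximation[OF prob_space_axioms rv bm bound]) simp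
  then obtain g where g: "\<And>i::nat. simple_function borel (g i)"
    and dist_g: "\<And>i a. norm (a - g i a) \<le> max (1 / real (Suc i)) (norm a)"
    and err: "\<And>i. (\<integral>\<omega>. norm (Z 0 \<omega> - g i (Z 0 \<omega>)) \<partial>M) \<le> 1 / real (Suc i)"
    by metis
  have err_lim: "(\<lambda>i. \<integral>\<omega>. norm (Z 0 \<omega> - g i (Z 0 \<omega>)) \<partial>M) \<longlonglongrightarrow> 0"
  proof (rule tendsto_sandwich[OF _ _ tendsto_const LIMSEQ_inverse_real_of_nat])
    show "eventually (\<lambda>i. 0 \<le> (\<integral>\<omega>. norm (Z 0 \<omega> - g i (Z 0 \<omega>)) \<partial>M)) sequentially"
      by (simp add: integral_nonneg_AE)
    show "eventually (\<lambda>i. (\<integral>\<omega>. norm (Z 0 \<omega> - g i (Z 0 \<omega>)) \<partial>M) \<le> inverse (real (Suc i))) sequentially"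
      using err by (simp only: inverse_eq_divide always_eventually simp_thms)
  qed
  define I where "I i = Bochner_Integration.simple_bochner_integral M (\<lambda>\<omega>. g i (Z 0 \<omega>))" for i
  have r_meas [measurable]: "(\<lambda>a. norm (a - g i a)) \<in> borel \<rightarrow>\<^sub>M borel" for i
    by (rule borel_measurable_norm_diff_simple[OF _ g]) measurable
  have r_bound: "AE \<omega> in M. \<bar>norm (Z 0 \<omega> - g i (Z 0 \<omega>))\<bar> \<le> max (1 / real (Suc i)) C" for i
    using bound
  proof eventually_elim
    case (elim \<omega>)
    then show ?case using dist_g[of "Z 0 \<omega>" i] by simp
  qed
  have I_lim: "I \<longlonglongrightarrow> bochner_int M (Z 0)"
    unfolding I_def
  proof (rule has_bochner_int_limit[OF rv bm])
    show "Bochner_Integration.simple_bochner_integrable M (\<lambda>\<omega>. g i (Z 0 \<omega>))" for i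
      using simple_function_comp[OF rv g, of i 0]
      by (auto intro!: simple_bochner_integrable.intros simp: o_def)
    have "(\<integral>\<^sup>+\<omega>. ennreal (norm (Z 0 \<omega> - g i (Z 0 \<omega>))) \<partial>M)
        = ennreal (\<integral>\<omega>. norm (Z 0 \<omega> - g i (Z 0 \<omega>)) \<partial>M)" for i
    proof (rule nn_integral_eq_integral)
      show "integrable M (\<lambda>\<omega>. norm (Z 0 \<omega> - g i (Z 0 \<omega>)))"
        by (rule integrable_const_bound[where B = "max (1 / real (Suc i)) C"])
          (use r_bound[of i] measurable_compose[OF rv r_meas] in simp_all)
    qed simp
    then show "(\<lambda>i. \<integral>\<^sup>+\<omega>. ennreal (norm (Z 0 \<omega> - g i (Z 0 \<omega>))) \<partial>M) \<longlonglongrightarrow> 0"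
      using tendsto_ennrealI[OF err_lim] by (simp only: ennreal_0)
  qed
  have "AE \<omega> in M. \<forall>i. (\<lambda>n. (1 / real n) *\<^sub>R (\<Sum>k=1..n. g i (Z k \<omega>))) \<longlonglongrightarrow> I i"
    unfolding AE_all_countable I_def by (intro allI average_simple_tendsto_AE[OF prob_space_axioms iid g])
  moreover have "AE \<omega> in M. \<forall>i. (\<lambda>n. (\<Sum>k=1..n. norm (Z k \<omega> - g i (Z k \<omega>))) / real n)
      \<longlonglongrightarrow> (\<integral>\<omega>. norm (Z 0 \<omega> - g i (Z 0 \<omega>)) \<partial>M)"
    unfolding AE_all_countable
  proof
    fix i
    show "AE \<omega> in M. (\<lambda>n. (\<Sum>k=1..n. norm (Z k \<omega> - g i (Z k \<omega>))) / real n)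
        \<longlonglongrightarrow> (\<integral>\<omega>. norm (Z 0 \<omega> - g i (Z 0 \<omega>)) \<partial>M)"
      by (rule average_tendsto_expectation_AE[OF prob_space_axioms
            iid_compose[OF prob_space_axioms iid r_meas[of i]] r_bound[of i]])
  qed
  ultimately show ?thesis
  proof eventually_elim
    case (elim \<omega>)
    have close: "dist ((1 / real n) *\<^sub>R (\<Sum>k=1..n. Z k \<omega>)) ((1 / real n) *\<^sub>R (\<Sum>k=1..n. g i (Z k \<omega>)))
        \<le> (\<Sum>k=1..n. norm (Z k \<omega> - g i (Z k \<omega>))) / real n" for i n
    proof -
      have "(1 / real n) *\<^sub>R (\<Sum>k=1..n. Z k \<omega>) - (1 / real n) *\<^sub>R (\<Sum>k=1..n. g i (Z k \<omega>))
          = (1 / real n) *\<^sub>R (\<Sum>k=1..n. Z k \<omega> - g i (Z k \<omega>))"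
        by (simp only: scaleR_diff_right sum_subtractf)
      then have "dist ((1 / real n) *\<^sub>R (\<Sum>k=1..n. Z k \<omega>)) ((1 / real n) *\<^sub>R (\<Sum>k=1..n. g i (Z k \<omega>)))
          = norm (\<Sum>k=1..n. Z k \<omega> - g i (Z k \<omega>)) / real n"
        by (simp only: dist_norm norm_scaleR) simp
      also have "\<dots> \<le> (\<Sum>k=1..n. norm (Z k \<omega> - g i (Z k \<omega>))) / real n"
        by (intro divide_right_mono norm_sum) simp
      finally show ?thesis .
    qed
    show ?case
      by (rule tendsto_by_approximations[OF spec[OF elim(1)] spec[OF elim(2)] close err_lim I_lim])
  qed
qed

lemma iid_AE_norm_le:
  fixes Z :: "nat \<Rightarrow> 'w \<Rightarrow> 'b::real_normed_vector"
  assumes "prob_space M" and iid: "iid M Z" and bound: "AE \<omega> in M. norm (Z i \<omega>) \<le> C"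
  shows "AE \<omega> in M. norm (Z j \<omega>) \<le> C"
proof -
  interpret prob_space M by fact
  have rv: "Z k \<in> M \<rightarrow>\<^sub>M borel" for k
    using iid by (auto simp: iid_def indep_vars_def)
  have dist: "distr M borel (Z i) = distr M borel (Z j)"
    using iid by (auto simp: iid_def)
  have S: "{a \<in> space borel. norm (a :: 'b) \<le> C} \<in> sets borel"
    by (simp add: closed_Collect_le continuous_on_norm_id borel_closed)
  show ?thesis
    using bound dist AE_distr_iff[OF rv S, of i] AE_distr_iff[OF rv S, of j] by metis
qed

section \<open>Almost sure convergence of the random products\<close>

theorem theorem2p5:
  fixes M :: "'w measure"
    and scaleK :: "'k::real_normed_field \<Rightarrow> 'a::banach \<Rightarrow> 'a"
    and A :: "'w \<Rightarrow> 'a \<Rightarrow>\<^sub>L 'a"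
    and As :: "nat \<Rightarrow> 'w \<Rightarrow> 'a \<Rightarrow>\<^sub>L 'a"
    and x :: 'a and f :: "'a \<Rightarrow>\<^sub>L 'k" and T :: real
  assumes "prob_space M" and "complete_measure M"
    and "banach_space_over scaleK"
    and "random_operator M scaleK A"
    and "\<exists>C. AE \<omega> in M. norm (A \<omega>) \<le> C"
    and "\<And>k. k \<ge> 1 \<Longrightarrow> random_operator M scaleK (As k)"
    and "iid M (\<lambda>k. if k = 0 then A else As k)"
    and "f \<in> dual_space scaleK" and "T > 0"
  shows "AE \<omega> in M.
    (\<lambda>n. SUP t\<in>{0..T}.
       norm (blinfun_apply f (blinfun_apply
         (op_prod (\<lambda>k. op_exp ((t / real n) *\<^sub>R As k \<omega>)) n
            - op_exp (t *\<^sub>R bochner_int M A)) x))) \<longlonglongrightarrow> 0"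
proof -
  define Z where "Z = (\<lambda>k. if k = 0 then A else As k)"
  have iid: "iid M Z" using assms(7) by (simp add: Z_def)
  have Z0: "Z 0 = A" by (simp add: Z_def)
  have bm: "bochner_measurable M (Z 0)" using assms(4) by (simp add: random_operator_def Z0)
  obtain C where C: "AE \<omega> in M. norm (Z 0 \<omega>) \<le> C" using assms(5) by (auto simp: Z0)
  have bound: "AE \<omega> in M. \<forall>k. norm (Z k \<omega>) \<le> C"
    unfolding AE_all_countable by (intro allI iid_AE_norm_le[OF assms(1) iid C])
  from bound average_tendsto_bochner_int_AE[OF assms(1) iid bm C]
  show ?thesis
  proof eventually_elim
    case (elim \<omega>)
    have Z_As: "Z k \<omega> = As k \<omega>" if "1 \<le> k" for k using that by (simp add: Z_def)
    define W where "W n t = op_prod (\<lambda>k. op_exp ((t / real n) *\<^sub>R As k \<omega>)) n" for n t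
    define E where "E t = op_exp (t *\<^sub>R bochner_int M A)" for t
    have unif: "uniform_limit {0..T} W E sequentially"
      unfolding W_def E_def
    proof (rule op_prod_exp_uniform_limit)
      show "norm (As k \<omega>) \<le> C" if "1 \<le> k" for k
        using elim(1) Z_As[OF that] by metis
      have "(\<Sum>k=1..n. Z k \<omega>) = (\<Sum>k=1..n. As k \<omega>)" for n
        by (intro sum.cong) (auto simp: Z_def)
      then show "(\<lambda>n. (1 / real n) *\<^sub>R (\<Sum>k=1..n. As k \<omega>)) \<longlonglongrightarrow> bochner_int M A"
        using elim(2) by (simp add: Z0)
    qed
    have "(\<lambda>n. SUP t\<in>{0..T}. norm (blinfun_apply f (blinfun_apply (W n t - E t) x))) \<longlonglongrightarrow> 0"
    proof (rule tendstoI)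
      fix e :: real assume e: "0 < e"
      \<comment> \<open>the summand \<open>1\<close> keeps \<open>q\<close> positive when \<open>f\<close> or \<open>x\<close> vanishes\<close>
      define q where "q = norm f * norm x + 1"
      have q: "0 < q" by (simp add: q_def add_nonneg_pos)
      from e q have "0 < e / (2 * q)" by simp
      from uniform_limitD[OF unif this]
      show "eventually (\<lambda>n. dist (SUP t\<in>{0..T}. norm (blinfun_apply f (blinfun_apply (W n t - E t) x))) 0 < e) sequentially"
      proof eventually_elim
        case (elim n)
        have le: "norm (blinfun_apply f (blinfun_apply (W n t - E t) x)) \<le> e / 2" if "t \<in> {0..T}" for t
        proof -
          have "norm (blinfun_apply f (blinfun_apply (W n t - E t) x)) \<le> norm f * (norm (W n t - E t) * norm x)"
            by (rule order_trans[OF norm_blinfun]) (intro mult_left_mono norm_blinfun norm_ge_zero)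
          also have "\<dots> = norm (W n t - E t) * (norm f * norm x)" by simp
          also have "\<dots> \<le> (e / (2 * q)) * q"
            using elim that e q by (intro mult_mono) (auto simp: dist_norm q_def intro: less_imp_le)
          also have "\<dots> = e / 2" using q by simp
          finally show ?thesis .
        qed
        have "(SUP t\<in>{0..T}. norm (blinfun_apply f (blinfun_apply (W n t - E t) x))) \<le> e / 2"
          using assms(9) le by (intro cSUP_least) auto
        moreover have "0 \<le> (SUP t\<in>{0..T}. norm (blinfun_apply f (blinfun_apply (W n t - E t) x)))"
          using assms(9) le by (intro cSUP_upper2[where x = 0]) (auto intro!: bdd_aboveI2[where M = "e / 2"])
        ultimately show ?case using e by (simp add: dist_real_def)
      qed
    qed
    then show ?case by (simp add: W_def E_def)
  qed
qed

end
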